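(* Let $\alpha = 0.1101110010111011\ldots_2$ be the Champernowne constant in base $2$, and for $n \in \mathbb{N} = \{1,2,3,\ldots\}$ let $x_n = \{2^n \alpha\}$. Then the sequence $(x_n)_{n \in \mathbb{N}}$ does not have Poissonian pair correlations; that is, it is not the case that for every real $s \geq 0$ $$\lim_{N \to \infty} \frac{1}{N} \# \left\{ (l,m) : 1 \leq l, m \leq N,\ l \neq m,\ \| x_l - x_m \| \leq \frac{s}{N} \right\} = 2s .$$
   Context: The Champernowne constant in base $2$ is the real number in $(0,1)$ whose binary expansion after the binary point is the concatenation of the binary expansions (with leading digit $1$) of the positive integers $1, 2, 3, 4, 5, \ldots$ in increasing order, i.e. the concatenation of $1, 10, 11, 100, 101, 110, \ldots$. $\{x\}$ denotes the fractional part of a real number $x$, and $\|x\|$ denotes the distance from $x$ to the nearest integer. A sequence $(x_n)_{n\in\mathbb{N}}$ in $[0,1)$ has Poissonian pair correlations if for every real $s \ge 0$ the number of ordered pairs $(l,m)$ with $1 \le l \ne m \le N$ and $\|x_l - x_m\| \le s/N$, divided by $N$, converges to $2s$ as $N \to \infty$. *)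

theory Defs
  imports "HOL-Analysis.Analysis"
begin

text \<open>Binary digits of a natural number, most significant digit first; the list of a positive
  number starts with 1, and 0 has the empty list.\<close>

fun bin_digits :: "nat \<Rightarrow> nat list" where
  "bin_digits n = (if n = 0 then [] else bin_digits (n div 2) @ [n mod 2])"

declare bin_digits.simps [simp del]

text \<open>Digit number \<open>i\<close>, counted from 0, of the infinite concatenation of the expansions of
  1, 2, 3, ... Every expansion is nonempty, so those of \<open>1, ..., i + 1\<close> already reach position
  \<open>i\<close>; by \<open>champernowne_digit_eq\<close> below, any longer concatenation has the same digit there.\<close>

definition champernowne_digit :: "nat \<Rightarrow> nat" where
  "champernowne_digit i = concat (map bin_digits [1..<i + 2]) ! i"

definition champernowne2 :: real where
  "champernowne2 = (\<Sum>i. real (champernowne_digit i) / 2 ^ (i + 1))"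

definition dist_nearest_int :: "real \<Rightarrow> real" where
  "dist_nearest_int x = infdist x \<int>"

text \<open>The sequence is \<open>x 1, x 2, ...\<close>; the value \<open>x 0\<close> plays no role. Its values are meant to lie
  in \<open>[0, 1)\<close>, which the definition does not enforce.\<close>

definition poissonian_pair_correlations :: "(nat \<Rightarrow> real) \<Rightarrow> bool" where
  "poissonian_pair_correlations x \<longleftrightarrow>
     (\<forall>s\<ge>0. (\<lambda>N. real (card {(l, m). l \<in> {1..N} \<and> m \<in> {1..N} \<and> l \<noteq> m \<and>
                               dist_nearest_int (x l - x m) \<le> s / real N}) / real N)
             \<longlonglongrightarrow> 2 * s)"

lemma length_bin_digits_pos: "n > 0 \<Longrightarrow> 0 < length (bin_digits n)"
  by (subst bin_digits.simps) simp

lemma concat_bin_digits_Suc: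
  "concat (map bin_digits [1..<Suc n + 1]) = concat (map bin_digits [1..<n + 1]) @ bin_digits (Suc n)"
  using upt_Suc_append[of 1 "n + 1"] by simp

lemma length_concat_bin_digits: "n \<le> length (concat (map bin_digits [1..<n + 1]))"
proof (induction n)
  case (Suc n)
  then show ?case
    using length_bin_digits_pos[of "Suc n"] unfolding concat_bin_digits_Suc length_append by linarith
qed simp

lemma champernowne_digit_eq:
  assumes "i < length (concat (map bin_digits [1..<n + 1]))"
  shows "champernowne_digit i = concat (map bin_digits [1..<n + 1]) ! i"
proof -
  let ?C = "\<lambda>n. concat (map bin_digits [1..<n + 1])"
  have app: "\<exists>ys. ?C (a + d) = ?C a @ ys" for a d
  proof (induction d)
    case (Suc d)
    then show ?case
      using concat_bin_digits_Suc[of "a + d"] by (metis add_Suc_right append.assoc)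
  qed simp
  have mono: "?C b ! i = ?C a ! i" if "a \<le> b" "i < length (?C a)" for a b
    using app[of a "b - a"] that by (metis le_add_diff_inverse nth_append)
  have len: "i < length (?C (i + 1))"
    using length_concat_bin_digits[of "i + 1"] by linarith
  have "?C n ! i = ?C (i + 1) ! i"
    using mono[of n "i + 1"] mono[of "i + 1" n] assms len by (cases "n \<le> i + 1") auto
  moreover have "champernowne_digit i = ?C (i + 1) ! i"
    unfolding champernowne_digit_def by (simp only: add.assoc one_add_one)
  ultimately show ?thesis by simp
qed

lemma bin_digits_le_1: "d \<in> set (bin_digits n) \<Longrightarrow> d \<le> 1"
proof (induction n rule: bin_digits.induct)
  case (1 n)
  then show ?case
    by (subst (asm) (2) bin_digits.simps) (auto split: if_splits)
qed

lemma champernowne_digit_le_1: "champernowne_digit i \<le> 1"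
proof -
  have "i < length (concat (map bin_digits [1..<i + 2]))"
    using length_concat_bin_digits[of "i + 1"] by (simp only: add.assoc one_add_one)
  from nth_mem[OF this] show ?thesis
    unfolding champernowne_digit_def by (auto dest: bin_digits_le_1)
qed

lemma summable_champernowne: "summable (\<lambda>i. real (champernowne_digit i) / 2 ^ (i + 1))"
proof (rule summable_comparison_test')
  show "summable (\<lambda>i. (1 / 2 :: real) ^ i)"
    by (rule summable_geometric) simp
  fix i :: nat
  assume "i \<ge> 0"
  have "real (champernowne_digit i) \<le> 1"
    using champernowne_digit_le_1[of i] by simp
  then show "norm (real (champernowne_digit i) / 2 ^ (i + 1)) \<le> (1 / 2) ^ i"
    by (simp add: power_one_over divide_simps)
qed

end

theory Submission
  imports Defs
begin

text \<open>Write \<open>\<alpha>\<close> for the Champernowne constant. The sequence has far too many close pairs: already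
  for \<open>s = 1\<close> the pair counts divided by \<open>N\<close> are unbounded, whereas they ought to tend to 2.

  The reason is that within the block of the \<open>d\<close>-digit numbers the digit string looks almost
  periodic with period \<open>d\<close>, since consecutive numbers share most of their leading digits. Cut a
  \<open>d\<close>-digit number \<open>n = A B C\<close> into blocks of \<open>a\<close>, \<open>b\<close> and \<open>c\<close> digits, with \<open>A\<close> and \<open>C\<close>
  starting with the digit 1, and let \<open>n' = C A B\<close>. Reading the string from the end of the block
  \<open>A\<close> in \<open>n\<close> gives \<open>B C\<close> followed by \<open>n + 1\<close>, so essentially \<open>B C A B\<close>; reading it from the
  end of the block \<open>A\<close> in \<open>n'\<close> gives \<open>B\<close> followed by \<open>n' + 1\<close>, so essentially \<open>B C A B\<close> as
  well. The two shifts of \<open>\<alpha>\<close> therefore agree modulo 1 up to about \<open>2 powr (- (b + d))\<close>. Agreement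
  of \<open>d\<close> digits is arranged by the choice of \<open>n'\<close>, and that of the next \<open>b\<close> digits comes for free.
  This is \<open>rotation_close\<close>; it is proved with real numbers instead of digit comparisons, which
  makes the carry in \<open>B + 1\<close> or \<open>C + 1\<close> harmless.

  For \<open>d = 4 * q\<close> and \<open>a, c \<le> q\<close> the block \<open>B\<close> has at least \<open>d / 2\<close> digits, so these pairs are
  at distance at most \<open>1 / N\<close> if \<open>q \<ge> 2\<close>, with \<open>N = d * 2 ^ d\<close>, a bound for the position where the \<open>d\<close>-digit numbers
  end. There are \<open>q\<^sup>2\<close> choices of \<open>(a, c)\<close> and \<open>2 ^ (d - 3)\<close> choices of the blocks, hence at least
  \<open>q / 32\<close> pairs per index (\<open>card_close_pairs_ge\<close>).\<close>

section \<open>Lengths and values of binary expansions\<close>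

lemma length_bin_digits_bounds:
  assumes "n > 0"
  shows "2 ^ (length (bin_digits n) - 1) \<le> n \<and> n < 2 ^ length (bin_digits n)"
  using assms
proof (induction n rule: bin_digits.induct)
  case (1 n)
  show ?case
  proof (cases "n = 1")
    case True
    then show ?thesis by (simp add: bin_digits.simps)
  next
    case False
    let ?k = "length (bin_digits (n div 2))"
    have IH: "2 ^ (?k - 1) \<le> n div 2" "n div 2 < 2 ^ ?k" and pos: "?k > 0"
      using 1 False length_bin_digits_pos[of "n div 2"] by auto
    have "length (bin_digits n) = Suc ?k"
      using 1 by (subst bin_digits.simps) simp
    moreover have "2 ^ ?k = 2 * (2::nat) ^ (?k - 1)"
      using pos by (metis power_minus_mult mult.commute)
    ultimately show ?thesis using IH by (simp, linarith)
  qed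
qed

lemma length_bin_digits_eqI:
  assumes "2 ^ (d - 1) \<le> n" "n < 2 ^ d"
  shows "length (bin_digits n) = d"
proof -
  let ?k = "length (bin_digits n)"
  have "n > 0" using assms(1) by (metis less_le_trans zero_less_numeral zero_less_power)
  then have k: "2 ^ (?k - 1) \<le> n" "n < 2 ^ ?k" "?k > 0"
    using length_bin_digits_bounds length_bin_digits_pos by auto
  have "d > 0" using assms by (cases d) auto
  have "?k - 1 < d" "d - 1 < ?k"
    using k assms by (meson le_less_trans less_exp power_less_imp_less_exp one_less_numeral_iff semiring_norm(76))+
  then show ?thesis using \<open>d > 0\<close> k(3) by linarith
qed

text \<open>Horner evaluation of a digit string: reading one more number appends its digits to the value
  accumulated so far. The general start value is what makes concatenations of expansions
  computable one number at a time.\<close>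

lemma foldl_bin_digits:
  "foldl (\<lambda>v x. 2 * v + x) v (bin_digits n) = v * 2 ^ length (bin_digits n) + n"
proof (induction n rule: bin_digits.induct)
  case (1 n)
  show ?case
  proof (cases "n = 0")
    case True
    then show ?thesis by (simp add: bin_digits.simps)
  next
    case False
    have eq: "bin_digits n = bin_digits (n div 2) @ [n mod 2]"
      using False by (subst bin_digits.simps) simp
    have "foldl (\<lambda>v x. 2 * v + x) v (bin_digits n)
      = 2 * (v * 2 ^ length (bin_digits (n div 2)) + n div 2) + n mod 2"
      unfolding eq using 1[OF False] by simp
    also have "\<dots> = v * 2 ^ length (bin_digits n) + n"
      unfolding eq by (simp add: algebra_simps)
    finally show ?thesis .
  qed
qed

section \<open>Shifts of the Champernowne constant\<close>

text \<open>The digits of \<open>n\<close> occupy the positions from \<open>start_pos n\<close> on, counted from 0, so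
  \<open>2 ^ start_pos n * champernowne2\<close> has the digits of \<open>n\<close> directly after its binary point, and
  its integer part is \<open>prefix_value n\<close>.\<close>

definition start_pos :: "nat \<Rightarrow> nat" where
  "start_pos n = length (concat (map bin_digits [1..<n]))"

definition prefix_value :: "nat \<Rightarrow> nat" where
  "prefix_value n = foldl (\<lambda>v x. 2 * v + x) 0 (concat (map bin_digits [1..<n]))"

lemma start_pos_Suc: "n > 0 \<Longrightarrow> start_pos (Suc n) = start_pos n + length (bin_digits n)"
  by (simp add: start_pos_def)

lemma prefix_value_Suc:
  "n > 0 \<Longrightarrow> prefix_value (Suc n) = prefix_value n * 2 ^ length (bin_digits n) + n"
  by (simp add: prefix_value_def foldl_bin_digits)

lemma map_champernowne_digit:
  assumes "n > 0"
  shows "map champernowne_digit [0..<start_pos n] = concat (map bin_digits [1..<n])"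
proof (rule nth_equalityI)
  show "length (map champernowne_digit [0..<start_pos n])
      = length (concat (map bin_digits [1..<n]))"
    by (simp add: start_pos_def)
next
  fix i assume "i < length (map champernowne_digit [0..<start_pos n])"
  then show "map champernowne_digit [0..<start_pos n] ! i = concat (map bin_digits [1..<n]) ! i"
    using champernowne_digit_eq[of i "n - 1"] assms by (simp add: start_pos_def)
qed

text \<open>The digits after the first \<open>k\<close> ones contribute at most a geometric series. Both bounds are
  non-strict, which suffices below and avoids excluding an expansion ending in ones.\<close>

lemma champernowne_shift_bounds:
  fixes k :: nat
  defines "S \<equiv> foldl (\<lambda>v x. 2 * v + x) 0 (map champernowne_digit [0..<k])"
  shows "real S \<le> 2 ^ k * champernowne2" "2 ^ k * champernowne2 \<le> real S + 1"
proof -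
  let ?f = "\<lambda>i. real (champernowne_digit i) / 2 ^ (i + 1)"
  have S: "real S = 2 ^ k * (\<Sum>i<k. ?f i)"
    unfolding S_def by (induction k) (simp_all add: algebra_simps)
  have split: "champernowne2 = (\<Sum>i. ?f (i + k)) + (\<Sum>i<k. ?f i)"
    unfolding champernowne2_def by (rule suminf_split_initial_segment[OF summable_champernowne])
  have sumf: "summable (\<lambda>i. ?f (i + k))"
    using summable_champernowne by (subst summable_iff_shift)
  have geo: "(\<lambda>i. (1 / 2) ^ k * ((1 / 2) ^ Suc i :: real)) sums ((1 / 2) ^ k * 1)"
    by (rule sums_mult[OF power_half_series])
  have le: "?f (i + k) \<le> (1 / 2) ^ k * ((1 / 2) ^ Suc i)" for i
    using champernowne_digit_le_1[of "i + k"]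
    by (simp add: power_one_over power_add field_simps)
  have "(\<Sum>i. ?f (i + k)) \<le> (1 / 2) ^ k"
    using suminf_le[OF le sumf sums_summable[OF geo]] sums_unique[OF geo] by simp
  moreover have "0 \<le> (\<Sum>i. ?f (i + k))"
    by (rule suminf_nonneg[OF sumf]) simp
  ultimately show "real S \<le> 2 ^ k * champernowne2" "2 ^ k * champernowne2 \<le> real S + 1"
    unfolding S split by (auto simp: algebra_simps power_one_over field_simps)
qed

text \<open>Two consecutive numbers of \<open>d\<close> digits determine the shift up to \<open>2 ^ (- 2 * d)\<close> modulo 1.
  That \<open>n + 1\<close> still has \<open>d\<close> digits is what fixes the scale of its contribution.\<close>

lemma champernowne_at_start:
  assumes "length (bin_digits n) = d" "length (bin_digits (n + 1)) = d" "n > 0"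
  obtains z :: int and e :: real where
    "2 ^ start_pos n * champernowne2
       = of_int z + real n / 2 ^ d + (real n + 1) / 2 ^ (2 * d) + e / 2 ^ (2 * d)"
    "0 \<le> e" "e \<le> 1"
proof
  let ?V = "prefix_value n" and ?N = "n + 2"
  define e where "e = 2 ^ start_pos ?N * champernowne2 - real (prefix_value ?N)"
  have pos: "start_pos ?N = start_pos n + 2 * d"
    using assms start_pos_Suc[of n] start_pos_Suc[of "Suc n"] by simp
  have val: "prefix_value ?N = (?V * 2 ^ d + n) * 2 ^ d + (n + 1)"
    using assms prefix_value_Suc[of n] prefix_value_Suc[of "Suc n"] by simp
  show "0 \<le> e" "e \<le> 1"
    using champernowne_shift_bounds[of "start_pos ?N"] map_champernowne_digit[of ?N]
    unfolding e_def prefix_value_def by auto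
  have "2 ^ (start_pos n + 2 * d) * champernowne2
      = real ?V * 2 ^ (2 * d) + real n * 2 ^ d + (real n + 1) + e"
    unfolding e_def pos[symmetric] unfolding val
    by (simp add: algebra_simps power_add mult_2_right)
  then have "2 ^ (2 * d) * (2 ^ start_pos n * champernowne2)
      = 2 ^ (2 * d) * (real ?V + real n / 2 ^ d + (real n + 1) / 2 ^ (2 * d) + e / 2 ^ (2 * d))"
    by (simp add: power_add mult_2 mult_2_right field_simps)
  then show "2 ^ start_pos n * champernowne2
       = of_int (int ?V) + real n / 2 ^ d + (real n + 1) / 2 ^ (2 * d) + e / 2 ^ (2 * d)"
    by simp
qed

lemma start_pos_mono: "m \<le> n \<Longrightarrow> start_pos m \<le> start_pos n"
proof (induction n rule: dec_induct)
  case (step n)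
  then show ?case by (simp add: start_pos_def)
qed simp

text \<open>A position lies in the expansion of exactly one number.\<close>

lemma start_pos_add_inject:
  assumes "start_pos m + a = start_pos n + b" "m > 0" "n > 0"
    "a < length (bin_digits m)" "b < length (bin_digits n)"
  shows "m = n \<and> a = b"
proof -
  have "\<not> m < n" "\<not> n < m"
    using assms start_pos_mono[of "Suc m" n] start_pos_mono[of "Suc n" m]
      start_pos_Suc[of m] start_pos_Suc[of n] by auto
  then show ?thesis using assms(1) by simp
qed

lemma start_pos_le:
  assumes "n < 2 ^ d"
  shows "start_pos (Suc n) \<le> d * n"
  using assms
proof (induction n)
  case (Suc n)
  have "length (bin_digits (Suc n)) - 1 < d"
    using length_bin_digits_bounds[of "Suc n"] Suc.prems
    by (meson le_less_trans power_less_imp_less_exp one_less_numeral_iff semiring_norm(76) zero_less_Suc)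
  then show ?case using Suc start_pos_Suc[of "Suc n"] by simp
qed (simp add: start_pos_def)

section \<open>Rotated integers produce close pairs\<close>

lemma mult_power_add_less:
  fixes x y :: nat
  assumes "x < 2 ^ p" "y < 2 ^ q"
  shows "x * 2 ^ q + y < 2 ^ (p + q)"
proof -
  have "x * 2 ^ q + y < (x + 1) * 2 ^ q" using assms by simp
  also have "\<dots> \<le> 2 ^ p * 2 ^ q" using assms by (intro mult_right_mono) auto
  finally show ?thesis by (simp add: power_add)
qed

lemma mult_power_add_inject:
  fixes u v u' v' :: nat
  assumes "u * 2 ^ k + v = u' * 2 ^ k + v'" "v < 2 ^ k" "v' < 2 ^ k"
  shows "u = u' \<and> v = v'"
proof -
  have "u = (u * 2 ^ k + v) div 2 ^ k" using assms(2) by simp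
  also have "\<dots> = u'" unfolding assms(1) using assms(3) by simp
  finally show ?thesis using assms(1) by simp
qed

text \<open>Concatenating digit blocks is addition after a shift. The condition \<open>B + 1 < 2 ^ k\<close> says
  that the lower block is not all ones, so that passing to the successor produces no carry into
  \<open>A\<close> and leaves the number of digits unchanged.\<close>

lemma length_bin_digits_append:
  assumes "A \<in> {2 ^ (a - 1)..<2 ^ a}" "a \<ge> 1" "B + 1 < (2::nat) ^ k"
  shows "length (bin_digits (A * 2 ^ k + B)) = a + k"
    and "length (bin_digits (A * 2 ^ k + B + 1)) = a + k"
proof -
  have lo: "2 ^ (a + k - 1) \<le> A * 2 ^ k"
    using assms by (cases a) (auto simp: power_add)
  have hi: "A * 2 ^ k + (B + 1) < 2 ^ (a + k)"
    by (rule mult_power_add_less) (use assms in auto)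
  show "length (bin_digits (A * 2 ^ k + B)) = a + k"
    "length (bin_digits (A * 2 ^ k + B + 1)) = a + k"
    by (rule length_bin_digits_eqI; use lo hi in linarith)+
qed

text \<open>Fractional parts drop out of the pair correlation condition, because they change a number by
  an integer only.\<close>

lemma dist_nearest_int_frac_le:
  assumes "\<bar>x - y - of_int z\<bar> \<le> r"
  shows "dist_nearest_int (frac x - frac y) \<le> r"
proof -
  have "dist_nearest_int (frac x - frac y) \<le> dist (frac x - frac y) (of_int (z - \<lfloor>x\<rfloor> + \<lfloor>y\<rfloor>))"
    unfolding dist_nearest_int_def by (rule infdist_le) simp
  also have "\<dots> = \<bar>x - y - of_int z\<bar>"
    by (simp add: dist_real_def frac_def)
  finally show ?thesis using assms by simp
qed

text \<open>The source of the close pairs. Both shifts equal \<open>B / 2 ^ b + C / 2 ^ (b + c)\<close> plus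
  \<open>A / 2 ^ d + B / 2 ^ (b + d)\<close> modulo 1, up to terms of order \<open>2 ^ (- b - d)\<close>: on one side
  \<open>C\<close> belongs to \<open>n\<close> and \<open>A B\<close> to \<open>n + 1\<close>, on the other \<open>C A B\<close> belongs to \<open>n' + 1\<close>. What
  remains is \<open>(C + 1 + e) / 2 ^ c - (1 + e')\<close> in units of \<open>2 ^ (- b - d)\<close>, where \<open>e\<close> and \<open>e'\<close>
  are the truncation errors, a difference of two numbers between 0 and 2.\<close>

lemma rotation_close:
  fixes A B C a b c :: nat
  assumes A: "A \<in> {2 ^ (a - 1)..<2 ^ a}" "a \<ge> 1"
    and C: "C \<in> {2 ^ (c - 1)..<2 ^ c}" "c \<ge> 1"
    and B: "B + 1 < 2 ^ b"
  defines "d \<equiv> a + b + c"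
    and "n \<equiv> A * 2 ^ (b + c) + (B * 2 ^ c + C)"
    and "n' \<equiv> C * 2 ^ (a + b) + (A * 2 ^ b + B)"
  shows "length (bin_digits n) = d" "length (bin_digits n') = d"
    "dist_nearest_int (frac (2 ^ (start_pos n + a) * champernowne2)
       - frac (2 ^ (start_pos n' + (a + c)) * champernowne2)) \<le> 2 / 2 ^ (b + d)"
proof -
  have BC: "B * 2 ^ c + C + 1 < 2 ^ (b + c)"
  proof -
    have "B * 2 ^ c + C + 1 \<le> (B + 1) * 2 ^ c" using C by simp
    also have "\<dots> < 2 ^ b * 2 ^ c" using B by (intro mult_strict_right_mono) auto
    finally show ?thesis by (simp add: power_add)
  qed
  have AB: "A * 2 ^ b + B + 1 < 2 ^ (a + b)"
    using mult_power_add_less[of A a "B + 1" b] A B by simp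
  have ln: "length (bin_digits n) = d" "length (bin_digits (n + 1)) = d"
    using length_bin_digits_append[OF A BC] unfolding n_def d_def by (simp_all add: ac_simps)
  have ln': "length (bin_digits n') = d" "length (bin_digits (n' + 1)) = d"
    using length_bin_digits_append[OF C AB] unfolding n'_def d_def by (simp_all add: ac_simps)
  show "length (bin_digits n) = d" "length (bin_digits n') = d" by fact+
  have "A > 0" "C > 0" using A C by (auto intro: less_le_trans[of 0 "2 ^ _"])
  then have "n > 0" "n' > 0" unfolding n_def n'_def by auto
  obtain z e where z: "2 ^ start_pos n * champernowne2
       = of_int z + real n / 2 ^ d + (real n + 1) / 2 ^ (2 * d) + e / 2 ^ (2 * d)"
    and e: "0 \<le> e" "e \<le> 1"
    using champernowne_at_start[OF ln \<open>n > 0\<close>] .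
  obtain z' e' where z': "2 ^ start_pos n' * champernowne2
       = of_int z' + real n' / 2 ^ d + (real n' + 1) / 2 ^ (2 * d) + e' / 2 ^ (2 * d)"
    and e': "0 \<le> e'" "e' \<le> 1"
    using champernowne_at_start[OF ln' \<open>n' > 0\<close>] .
  let ?x = "2 ^ (start_pos n + a) * champernowne2"
  let ?y = "2 ^ (start_pos n' + (a + c)) * champernowne2"
  define w :: int where "w = 2 ^ a * z + int A - (2 ^ (a + c) * z' + int C * 2 ^ a + int A)"
  \<comment> \<open>With the powers of 2 replaced by independent variables, the identities below become identities
    of rational functions.\<close>
  define p q r :: real where "p = 2 ^ a" and "q = 2 ^ b" and "r = 2 ^ c"
  have pos: "p > 0" "q > 0" "r > 0" by (simp_all add: p_def q_def r_def)
  have pw: "(2::real) ^ a = p" "(2::real) ^ b = q" "(2::real) ^ c = r" "(2::real) ^ d = p * q * r"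
    "(2::real) ^ (2 * d) = (p * q * r) * (p * q * r)"
    "(2::real) ^ (b + c) = q * r" "(2::real) ^ (a + c) = p * r" "(2::real) ^ (b + d) = q * (p * q * r)"
    "(2::real) ^ (d + b + c) = (p * q * r) * q * r" "(2::real) ^ (d + b) = (p * q * r) * q"
    unfolding p_def q_def r_def d_def by (simp_all only: power_add mult_2)
  have rn: "real n = A * (q * r) + (B * r + C)" "real n' = C * (p * q) + (A * q + B)"
    unfolding p_def q_def r_def n_def n'_def by (simp_all add: power_add)
  have "?x = 2 ^ a * (2 ^ start_pos n * champernowne2)" by (simp add: power_add)
  also have "\<dots> = of_int (2 ^ a * z + int A) + (B * 2 ^ c + C) / 2 ^ (b + c)
      + (real n + 1 + e) / 2 ^ (d + b + c)"
    unfolding z pw rn using pos by (simp add: pw(1-3,7) field_simps)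
  finally have x: "?x = \<dots>" .
  have "?y = 2 ^ (a + c) * (2 ^ start_pos n' * champernowne2)" by (simp add: power_add)
  also have "\<dots> = of_int (2 ^ (a + c) * z' + int C * 2 ^ a + int A) + B / 2 ^ b
      + (real n' + 1 + e') / 2 ^ (d + b)"
    unfolding z' pw rn using pos by (simp add: pw(1-3,7) field_simps)
  finally have y: "?y = \<dots>" .
  have xy: "?x - ?y - of_int w = ((real C + 1 + e) / 2 ^ c - 1 - e') / 2 ^ (b + d)"
    unfolding x y w_def pw rn using pos by (simp add: pw(1-3,7) field_simps)
  have "real C + 1 \<le> 2 ^ c"
    using C by (metis One_nat_def Suc_eq_plus1 Suc_leI atLeastLessThan_iff of_nat_1 of_nat_add of_nat_le_iff of_nat_numeral of_nat_power)
  then have u: "0 \<le> (real C + 1 + e) / 2 ^ c" "(real C + 1 + e) / 2 ^ c \<le> 2"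
    using e one_le_power[of "2::real" c] by (auto simp: field_simps)
  have "\<bar>?x - ?y - of_int w\<bar> \<le> 2 / 2 ^ (b + d)"
    unfolding xy abs_divide using u e' by (intro frac_le) auto
  then show "dist_nearest_int (frac ?x - frac ?y) \<le> 2 / 2 ^ (b + d)"
    by (rule dist_nearest_int_frac_le)
qed

section \<open>Counting the close pairs\<close>

text \<open>The pairs from \<open>rotation_close\<close> with \<open>a, c \<le> q\<close> and \<open>d = 4 * q\<close> are pairwise distinct: the
  two positions determine \<open>n\<close>, \<open>a\<close> and \<open>a + c\<close>, and these determine the cut of \<open>n\<close> and hence its
  three blocks.\<close>

lemma card_close_pairs_ge:
  fixes q :: nat
  assumes q: "q \<ge> 2"
  defines "N \<equiv> 4 * q * 2 ^ (4 * q)"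
    and "x \<equiv> \<lambda>n. frac (2 ^ n * champernowne2)"
  shows "q * q * 2 ^ (4 * q - 3) \<le> card {(l, m). l \<in> {1..N} \<and> m \<in> {1..N} \<and> l \<noteq> m \<and>
                               dist_nearest_int (x l - x m) \<le> 1 / real N}"
proof -
  let ?d = "4 * q"
  let ?R = "{(l, m). l \<in> {1..N} \<and> m \<in> {1..N} \<and> l \<noteq> m \<and>
                               dist_nearest_int (x l - x m) \<le> 1 / real N}"
  \<comment> \<open>The leading digits of \<open>A\<close> and \<open>C\<close> are 1. The leading digit of \<open>B\<close> is 0, a simple way to
    keep \<open>B\<close> from being all ones.\<close>
  define T where "T = (SIGMA (a, c) : {1..q} \<times> {1..q}.
    {2 ^ (a - 1)..<(2::nat) ^ a} \<times> {2 ^ (c - 1)..<(2::nat) ^ c} \<times> {..<(2::nat) ^ (?d - a - c - 1)})"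
  define n where "n = (\<lambda>a c A C B. A * 2 ^ ((?d - a - c) + c) + (B * 2 ^ c + C) :: nat)"
  define n' where "n' = (\<lambda>a c A C B. C * 2 ^ (a + (?d - a - c)) + (A * 2 ^ (?d - a - c) + B) :: nat)"
  define g where "g = (\<lambda>((a, c), A, C, B).
    (start_pos (n a c A C B) + a, start_pos (n' a c A C B) + (a + c)))"
  have cardT: "card T = q * q * 2 ^ (?d - 3)"
  proof -
    have one: "card ({2 ^ (a - 1)..<(2::nat) ^ a} \<times> {2 ^ (c - 1)..<(2::nat) ^ c} \<times> {..<(2::nat) ^ (?d - a - c - 1)})
       = 2 ^ (?d - 3)" if ac: "a \<in> {1..q}" "c \<in> {1..q}" for a c
    proof -
      have "(2::nat) ^ a - 2 ^ (a - 1) = 2 ^ (a - 1)" "(2::nat) ^ c - 2 ^ (c - 1) = 2 ^ (c - 1)"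
        using ac by (cases a; cases c; simp)+
      moreover have "?d - 3 = (a - 1) + (c - 1) + (?d - a - c - 1)" using ac q by simp
      ultimately show ?thesis
        unfolding card_cartesian_product card_atLeastLessThan card_lessThan
        by (simp add: power_add)
    qed
    have "card T = (\<Sum>p\<in>{1..q} \<times> {1..q}. card (case p of (a, c) \<Rightarrow>
        {2 ^ (a - 1)..<(2::nat) ^ a} \<times> {2 ^ (c - 1)..<(2::nat) ^ c}
          \<times> {..<(2::nat) ^ (?d - a - c - 1)}))"
      unfolding T_def by (rule card_SigmaI) auto
    also have "\<dots> = (\<Sum>p\<in>{1..q} \<times> {1..q}. 2 ^ (?d - 3))"
    proof (rule sum.cong[OF refl])
      fix p assume "p \<in> {1..q} \<times> {1..q}"
      then obtain a c where p: "p = (a, c)" "a \<in> {1..q}" "c \<in> {1..q}" by blast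
      show "card (case p of (a, c) \<Rightarrow>
        {2 ^ (a - 1)..<(2::nat) ^ a} \<times> {2 ^ (c - 1)..<(2::nat) ^ c}
          \<times> {..<(2::nat) ^ (?d - a - c - 1)}) = 2 ^ (?d - 3)"
        unfolding p(1) prod.case by (rule one[OF p(2,3)])
    qed
    finally have "card T = (\<Sum>p\<in>{1..q} \<times> {1..q}. 2 ^ (?d - 3))" .
    then show ?thesis by simp
  qed
  have facts: "length (bin_digits (n a c A C B)) = ?d \<and> length (bin_digits (n' a c A C B)) = ?d \<and>
      dist_nearest_int (x (start_pos (n a c A C B) + a) - x (start_pos (n' a c A C B) + (a + c)))
        \<le> 1 / real N \<and> n a c A C B \<noteq> 0 \<and> n' a c A C B \<noteq> 0 \<and> a \<in> {1..q} \<and> c \<in> {1..q}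
        \<and> C < 2 ^ c \<and> B < 2 ^ (?d - a - c)"
    if t: "((a, c), A, C, B) \<in> T" for a c A C B
  proof -
    let ?b = "?d - a - c"
    have ac: "a \<in> {1..q}" "c \<in> {1..q}" and A: "A \<in> {2 ^ (a - 1)..<2 ^ a}"
      and C: "C \<in> {2 ^ (c - 1)..<2 ^ c}" and B: "B < 2 ^ (?b - 1)"
      using t unfolding T_def by auto
    have b: "?b \<ge> 2 * q" and d: "a + ?b + c = ?d" using ac by auto
    then have "(2::nat) ^ ?b = 2 * 2 ^ (?b - 1)" using q by (cases ?b) auto
    with B have B': "B + 1 < 2 ^ ?b" by linarith
    have a1: "a \<ge> 1" "c \<ge> 1" using ac by auto
    note r = rotation_close[OF A a1(1) C a1(2) B', unfolded d]
    have len: "length (bin_digits (n a c A C B)) = ?d" "length (bin_digits (n' a c A C B)) = ?d"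
      unfolding n_def n'_def by (rule r(1), rule r(2))
    have close: "dist_nearest_int (x (start_pos (n a c A C B) + a)
        - x (start_pos (n' a c A C B) + (a + c))) \<le> 2 / 2 ^ (?b + ?d)"
      unfolding n_def n'_def x_def by (rule r(3))
    have "2 * N \<le> 2 ^ (?b + ?d)"
    proof -
      have "8 * q \<le> 2 ^ (2 * q)"
        using q
      proof (induction q rule: dec_induct)
        case (step m)
        then show ?case by simp
      qed simp
      also have "\<dots> \<le> 2 ^ ?b" using b by (intro power_increasing) auto
      finally have "8 * q * 2 ^ ?d \<le> 2 ^ ?b * 2 ^ ?d" by (rule mult_right_mono) simp
      then show ?thesis unfolding N_def by (simp add: power_add)
    qed
    then have "2 * real N \<le> 2 ^ (?b + ?d)"
      by (metis of_nat_le_iff of_nat_mult of_nat_numeral of_nat_power)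
    moreover have "real N > 0" using q unfolding N_def by simp
    ultimately have "2 / 2 ^ (?b + ?d) \<le> 1 / real N" by (simp add: field_simps)
    with close have close': "dist_nearest_int (x (start_pos (n a c A C B) + a)
        - x (start_pos (n' a c A C B) + (a + c))) \<le> 1 / real N"
      by (rule order_trans)
    have "k \<noteq> 0" if "length (bin_digits k) = ?d" for k
      using that q by (cases "k = 0") (simp_all add: bin_digits.simps)
    then have "n a c A C B \<noteq> 0" "n' a c A C B \<noteq> 0" using len by blast+
    moreover have "C < 2 ^ c" "B < 2 ^ ?b" using C B' by simp_all
    ultimately show ?thesis using len close' ac by blast
  qed
  have "inj_on g T"
  proof (rule inj_onI)
    fix t1 t2 assume mem: "t1 \<in> T" "t2 \<in> T" and geq: "g t1 = g t2"
    obtain a c A C B a2 c2 A2 C2 B2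
      where eqs: "t1 = ((a, c), A, C, B)" "t2 = ((a2, c2), A2, C2, B2)"
      by (metis surj_pair)
    note t = mem(1)[unfolded eqs] and t2 = mem(2)[unfolded eqs] and eq = geq[unfolded eqs]
    note f = facts[OF t] and f2 = facts[OF t2]
    have 1: "n a c A C B = n a2 c2 A2 C2 B2 \<and> a = a2"
      by (rule start_pos_add_inject) (use eq f f2 q in \<open>auto simp: g_def\<close>)
    have "n' a c A C B = n' a2 c2 A2 C2 B2 \<and> a + c = a2 + c2"
      by (rule start_pos_add_inject) (use eq f f2 q in \<open>auto simp: g_def\<close>)
    with 1 have ac: "a2 = a" "c2 = c" by auto
    let ?b = "?d - a - c"
    have lt: "C < 2 ^ c" "C2 < 2 ^ c" "B < 2 ^ ?b" "B2 < 2 ^ ?b"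
      using f f2 unfolding ac by blast+
    have "(A * 2 ^ ?b + B) * 2 ^ c + C = (A2 * 2 ^ ?b + B2) * 2 ^ c + C2"
      using 1 unfolding n_def ac by (simp add: power_add algebra_simps)
    then have AB: "A * 2 ^ ?b + B = A2 * 2 ^ ?b + B2 \<and> C = C2"
      using lt mult_power_add_inject by blast
    then have "A = A2 \<and> B = B2"
      using lt mult_power_add_inject by blast
    with AB ac show "t1 = t2" unfolding eqs by simp
  qed
  have "g ` T \<subseteq> ?R"
  proof (rule image_subsetI)
    fix t assume mem: "t \<in> T"
    obtain a c A C B where t: "t = ((a, c), A, C, B)" by (metis surj_pair)
    obtain l m where lm: "g t = (l, m)" by (metis surj_pair)
    have l: "l = start_pos (n a c A C B) + a" and m: "m = start_pos (n' a c A C B) + (a + c)"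
      using lm unfolding t g_def by simp_all
    note f = facts[OF mem[unfolded t]]
    then have ac: "1 \<le> a" "1 \<le> c" "a + c < ?d" using q by auto
    have le: "start_pos k + i \<le> N" if k: "k > 0" "length (bin_digits k) = ?d" and i: "i \<le> ?d" for k i
    proof -
      have lt: "k < 2 ^ ?d" using length_bin_digits_bounds[OF k(1)] k(2) by simp
      have "start_pos k + i \<le> start_pos (Suc k)" using start_pos_Suc[OF k(1)] k(2) i by simp
      also have "\<dots> \<le> ?d * k" by (rule start_pos_le[OF lt])
      also have "\<dots> \<le> N" unfolding N_def using lt by simp
      finally show ?thesis .
    qed
    have "l \<noteq> m"
    proof
      assume "l = m"
      then have "n a c A C B = n' a c A C B \<and> a = a + c"
        unfolding l m by (intro start_pos_add_inject) (use f ac in auto)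
      then show False using ac by simp
    qed
    moreover have "l \<le> N" "m \<le> N"
      unfolding l m using f ac by (auto intro!: le)
    moreover have "1 \<le> l" "1 \<le> m" unfolding l m using ac by simp_all
    moreover have "dist_nearest_int (x l - x m) \<le> 1 / real N"
      unfolding l m using f by blast
    ultimately show "g t \<in> ?R" unfolding lm by simp
  qed
  moreover have "finite ?R"
    by (rule finite_subset[of _ "{1..N} \<times> {1..N}"]) auto
  ultimately have "card (g ` T) \<le> card ?R" by (intro card_mono)
  then show ?thesis unfolding card_image[OF \<open>inj_on g T\<close>] cardT .
qed

theorem theorem1:
  shows "\<not> poissonian_pair_correlations (\<lambda>n. frac (2 ^ n * champernowne2))"
proof
  let ?x = "\<lambda>n. frac (2 ^ n * champernowne2)"
  let ?card = "\<lambda>N. card {(l, m). l \<in> {1..N} \<and> m \<in> {1..N} \<and> l \<noteq> m \<and>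
                               dist_nearest_int (?x l - ?x m) \<le> 1 / real N}"
  assume "poissonian_pair_correlations ?x"
  then have "(\<lambda>N. real (?card N) / real N) \<longlonglongrightarrow> 2 * 1"
    unfolding poissonian_pair_correlations_def by (elim allE[of _ 1]) simp
  then have "eventually (\<lambda>N. real (?card N) / real N < 3) sequentially"
    by (rule order_tendstoD) simp
  then obtain M where M: "real (?card N) / real N < 3" if "N \<ge> M" for N
    unfolding eventually_sequentially by blast
  \<comment> \<open>There are at least \<open>q / 32\<close> close pairs per index, which contradicts the limit 2 once
    \<open>q / 32 \<ge> 3\<close>.\<close>
  define q where "q = M + 96"
  define N where "N = 4 * q * 2 ^ (4 * q)"
  have "M \<le> q * 1" by (simp add: q_def)
  also have "\<dots> \<le> q * (4 * 2 ^ (4 * q))" by (rule mult_left_mono) auto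
  also have "\<dots> = N" unfolding N_def by simp
  finally have "N \<ge> M" .
  have "q * q * 2 ^ (4 * q - 3) \<le> ?card N"
    unfolding N_def by (rule card_close_pairs_ge) (simp add: q_def)
  moreover have "3 * N \<le> q * q * 2 ^ (4 * q - 3)"
  proof -
    have "4 * q = (4 * q - 3) + 3" by (simp add: q_def)
    then have "(2::nat) ^ (4 * q) = 2 ^ (4 * q - 3) * 2 ^ 3" by (metis power_add)
    then have "3 * N = q * (96 * 2 ^ (4 * q - 3))" unfolding N_def by simp
    also have "\<dots> \<le> q * (q * 2 ^ (4 * q - 3))"
      by (intro mult_left_mono mult_right_mono) (auto simp: q_def)
    finally show ?thesis by (simp add: mult.assoc)
  qed
  ultimately have "real (3 * N) \<le> real (?card N)"
    unfolding of_nat_le_iff by (rule le_trans[rotated])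
  moreover have "real N > 0" unfolding N_def q_def by simp
  ultimately have "3 \<le> real (?card N) / real N"
    unfolding of_nat_mult of_nat_numeral by (rule mult_imp_le_div_pos[rotated])
  then show False using M[OF \<open>N \<ge> M\<close>] by simp
qed

end
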